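(* Let $F$ be the map from the category $\mathcal{C}$ of $C^*$-correspondences to the category of $C^*$-algebras given on objects by $F(X,A)=\mathcal{O}_X$ and on a morphism $(\psi_X,\psi_A):(X,A)\to(Y,B)$ by $F(\psi_X,\psi_A)=\Psi$, where $\Psi:\mathcal{O}_X\to\mathcal{O}_Y$ is the unique $*$-homomorphism satisfying $\Psi\circ\pi_X=\pi_Y\circ\psi_X$ and $\Psi\circ\pi_A=\pi_B\circ\psi_A$. Then $F$ is a covariant functor from the category of $C^*$-correspondences to the category of $C^*$-algebras.
   Context: For a right Hilbert $A$-module $X$ over a $C^*$-algebra $A$, $\mathcal{L}(X)$ is the $C^*$-algebra of adjointable operators on $X$; for $\xi,\eta\in X$, $\theta_{\xi,\eta}\in\mathcal{L}(X)$ is $\theta_{\xi,\eta}(\zeta)=\xi\langle\eta,\zeta\rangle$; and $\mathcal{K}(X)=\overline{\operatorname{span}}\{\theta_{\xi,\eta}:\xi,\eta\in X\}$. A $C^*$-correspondence $(X,A)$ is a right Hilbert $A$-module $X$ together with a $*$-homomorphism $\phi_X:A\to\mathcal{L}(X)$ (the left action). Define the ideal $J_X=\{a\in A:\phi_X(a)\in\mathcal{K}(X)\text{ and }ab=0\text{ for all }b\in\ker(\phi_X)\}$ of $A$. A morphism $(\psi_X,\psi_A):(X,A)\to(Y,B)$ of $C^*$-correspondences is a pair consisting of a linear map $\psi_X:X\to Y$ and a $*$-homomorphism $\psi_A:A\to B$ such that: (C1) $\langle\psi_X(\xi),\psi_X(\eta)\rangle=\psi_A(\langle\xi,\eta\rangle)$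 for all $\xi,\eta\in X$; (C2) $\psi_X(\phi_X(a)\xi)=\phi_Y(\psi_A(a))\psi_X(\xi)$ for all $\xi\in X$, $a\in A$; (C3) $\psi_A(J_X)\subset J_Y$; (C4) $\phi_Y(\psi_A(a))=\psi_X^+(\phi_X(a))$ for all $a\in J_X$. Here $\psi_X^+:\mathcal{K}(X)\to\mathcal{K}(Y)$ is the $*$-homomorphism determined by $\psi_X^+(\theta_{\xi,\eta})=\theta_{\psi_X(\xi),\psi_X(\eta)}$ (it exists for pairs satisfying (C1)). The category $\mathcal{C}$ has as objects the $C^*$-correspondences $(X,A)$ and as morphisms the morphisms just defined, with componentwise composition and identities $\operatorname{id}_{(X,A)}=(\operatorname{id}_X,\operatorname{id}_A)$. The category of $C^*$-algebras has $*$-homomorphisms as morphisms. Any $C^*$-algebra $D$ gives a $C^*$-correspondence $(D,D)$ with left and right actions by multiplication and $\langle a,b\rangle=a^*b$; there is a canonical isomorphism $\mathcal{K}(D)\cong D$, $\theta_{a,b}\mapsto ab^*$. A covariant representation of $(X,A)$ on $D$ is a morphism $(\rho_X,\rho_A):(X,A)\to(D,D)$. $\mathcal{O}_X$ is the universal $C^*$-algebra for covariant representations: it is generated by the image of a covariant representation $(\pi_X,\pi_A)$ of $(X,A)$ on $\mathcal{O}_X$ (the universal covariant representation) such that every covariant representation $(\rho_X,\rho_A)$ of $(X,A)$ on a $C^*$-algebra $D$ factors as $\rho_X=P\circ\pi_X$, $\rho_A=P\circ\pi_A$ for a unique $*$-homomorphism $P:\mathcal{O}_X\to D$. In particular the $*$-homomorphism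 $\Psi$ associated to a morphism exists and is unique. *)

theory Defs
  imports
    "HOL-Library.FuncSet"
    "HOL-Analysis.Abstract_Metric_Spaces"
    "HOL-Algebra.Module"
    "HOL-Algebra.AbelCoset"
    "HOL-Algebra.Algebraic_Closure_Type"
begin

text \<open>All structures have explicit carriers, and the morphisms between them are extensional
  functions (\<open>undefined\<close> outside the carrier), so that equality of morphisms is equality in HOL.
  Every structure is a module over the field of complex numbers in the sense of HOL-Algebra.\<close>

text \<open>Frees the identifier \<open>X\<close>, which HOL-Algebra uses for the indeterminate of polynomials.\<close>

no_notation var (\<open>X\<index>\<close>)

abbreviation complex_field :: "complex ring"
  where "complex_field \<equiv> ring_of_type_algebra"

text \<open>The distance is set to 0 off the carrier because the locale \<^locale>\<open>Metric_space\<close> requires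
  nonnegativity and symmetry of the distance on the whole type.\<close>

definition norm_dist :: "('a, 'r) ring_scheme \<Rightarrow> ('a \<Rightarrow> real) \<Rightarrow> 'a \<Rightarrow> 'a \<Rightarrow> real"
  where "norm_dist V N x y =
    (if x \<in> carrier V \<and> y \<in> carrier V then N (x \<ominus>\<^bsub>V\<^esub> y) else 0)"


section \<open>C*-algebras\<close>

text \<open>C*-algebras need not be unital: the field \<^const>\<open>one\<close> inherited from
  \<open>ring\<close> is unused, as it is for modules in HOL-Algebra.\<close>

record 'a cstar = "(complex, 'a) module" +
  star :: "'a \<Rightarrow> 'a"
  nrm :: "'a \<Rightarrow> real"

locale cstar_algebra = Module.module complex_field A
  for A :: "'a cstar" (structure) +
  assumes mult_closed: "\<lbrakk>x \<in> carrier A; y \<in> carrier A\<rbrakk> \<Longrightarrow> x \<otimes> y \<in> carrier A"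
    and mult_assoc:
      "\<lbrakk>x \<in> carrier A; y \<in> carrier A; z \<in> carrier A\<rbrakk> \<Longrightarrow> (x \<otimes> y) \<otimes> z = x \<otimes> (y \<otimes> z)"
    and distrib_left:
      "\<lbrakk>x \<in> carrier A; y \<in> carrier A; z \<in> carrier A\<rbrakk> \<Longrightarrow> x \<otimes> (y \<oplus> z) = x \<otimes> y \<oplus> x \<otimes> z"
    and distrib_right:
      "\<lbrakk>x \<in> carrier A; y \<in> carrier A; z \<in> carrier A\<rbrakk> \<Longrightarrow> (x \<oplus> y) \<otimes> z = x \<otimes> z \<oplus> y \<otimes> z"
    and scale_mult_left:
      "\<lbrakk>x \<in> carrier A; y \<in> carrier A\<rbrakk> \<Longrightarrow> (c \<odot> x) \<otimes> y = c \<odot> (x \<otimes> y)"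
    and scale_mult_right:
      "\<lbrakk>x \<in> carrier A; y \<in> carrier A\<rbrakk> \<Longrightarrow> x \<otimes> (c \<odot> y) = c \<odot> (x \<otimes> y)"
    and star_closed: "x \<in> carrier A \<Longrightarrow> star A x \<in> carrier A"
    and star_star: "x \<in> carrier A \<Longrightarrow> star A (star A x) = x"
    and star_add:
      "\<lbrakk>x \<in> carrier A; y \<in> carrier A\<rbrakk> \<Longrightarrow> star A (x \<oplus> y) = star A x \<oplus> star A y"
    and star_scale: "x \<in> carrier A \<Longrightarrow> star A (c \<odot> x) = cnj c \<odot> star A x"
    and star_mult:
      "\<lbrakk>x \<in> carrier A; y \<in> carrier A\<rbrakk> \<Longrightarrow> star A (x \<otimes> y) = star A y \<otimes> star A x"
    and nrm_nonneg: "x \<in> carrier A \<Longrightarrow> 0 \<le> nrm A x"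
    and nrm_eq_0: "x \<in> carrier A \<Longrightarrow> nrm A x = 0 \<longleftrightarrow> x = \<zero>"
    and nrm_triangle:
      "\<lbrakk>x \<in> carrier A; y \<in> carrier A\<rbrakk> \<Longrightarrow> nrm A (x \<oplus> y) \<le> nrm A x + nrm A y"
    and nrm_scale: "x \<in> carrier A \<Longrightarrow> nrm A (c \<odot> x) = cmod c * nrm A x"
    and nrm_mult:
      "\<lbrakk>x \<in> carrier A; y \<in> carrier A\<rbrakk> \<Longrightarrow> nrm A (x \<otimes> y) \<le> nrm A x * nrm A y"
    and nrm_cstar: "x \<in> carrier A \<Longrightarrow> nrm A (star A x \<otimes> x) = (nrm A x)\<^sup>2"
    and nrm_complete: "Metric_space.mcomplete (carrier A) (norm_dist A (nrm A))"

definition cstar_positive :: "'a cstar \<Rightarrow> 'a set"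
  where "cstar_positive A = {star A b \<otimes>\<^bsub>A\<^esub> b | b. b \<in> carrier A}"

definition star_hom :: "'a cstar \<Rightarrow> 'b cstar \<Rightarrow> ('a \<Rightarrow> 'b) \<Rightarrow> bool"
  where "star_hom A B f \<longleftrightarrow> f \<in> carrier A \<rightarrow> carrier B \<and>
    (\<forall>x\<in>carrier A. \<forall>y\<in>carrier A. f (x \<oplus>\<^bsub>A\<^esub> y) = f x \<oplus>\<^bsub>B\<^esub> f y) \<and>
    (\<forall>c. \<forall>x\<in>carrier A. f (c \<odot>\<^bsub>A\<^esub> x) = c \<odot>\<^bsub>B\<^esub> f x) \<and>
    (\<forall>x\<in>carrier A. \<forall>y\<in>carrier A. f (x \<otimes>\<^bsub>A\<^esub> y) = f x \<otimes>\<^bsub>B\<^esub> f y) \<and>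
    (\<forall>x\<in>carrier A. f (star A x) = star B (f x))"

definition star_homs :: "'a cstar \<Rightarrow> 'b cstar \<Rightarrow> ('a \<Rightarrow> 'b) set"
  where "star_homs A B = {f \<in> extensional (carrier A). star_hom A B f}"

definition cstar_subalgebra :: "'a set \<Rightarrow> 'a cstar \<Rightarrow> bool"
  where "cstar_subalgebra S A \<longleftrightarrow>
    submodule S complex_field A \<and>
    (\<forall>x\<in>S. \<forall>y\<in>S. x \<otimes>\<^bsub>A\<^esub> y \<in> S) \<and>
    (\<forall>x\<in>S. star A x \<in> S) \<and>
    closedin (Metric_space.mtopology (carrier A) (norm_dist A (nrm A))) S"


section \<open>Hilbert modules and their operators\<close>

text \<open>The inner product is conjugate-linear in the first variable. The \<open>ring\<close> fields
  \<^const>\<open>monoid.mult\<close> and \<^const>\<open>one\<close> are unused here.\<close>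

record ('x, 'a) hilbert_module = "(complex, 'x) module" +
  ract :: "'x \<Rightarrow> 'a \<Rightarrow> 'x"
  inner :: "'x \<Rightarrow> 'x \<Rightarrow> 'a"

definition hnorm :: "'a cstar \<Rightarrow> ('x, 'a) hilbert_module \<Rightarrow> 'x \<Rightarrow> real"
  where "hnorm A X \<xi> = sqrt (nrm A (inner X \<xi> \<xi>))"

locale right_hilbert_module = A: cstar_algebra A + X: Module.module complex_field X
  for A :: "'a cstar" and X :: "('x, 'a) hilbert_module" +
  assumes ract_closed: "\<lbrakk>\<xi> \<in> carrier X; a \<in> carrier A\<rbrakk> \<Longrightarrow> ract X \<xi> a \<in> carrier X"
    and ract_add_left: "\<lbrakk>\<xi> \<in> carrier X; \<eta> \<in> carrier X; a \<in> carrier A\<rbrakk>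
      \<Longrightarrow> ract X (\<xi> \<oplus>\<^bsub>X\<^esub> \<eta>) a = ract X \<xi> a \<oplus>\<^bsub>X\<^esub> ract X \<eta> a"
    and ract_add_right: "\<lbrakk>\<xi> \<in> carrier X; a \<in> carrier A; b \<in> carrier A\<rbrakk>
      \<Longrightarrow> ract X \<xi> (a \<oplus>\<^bsub>A\<^esub> b) = ract X \<xi> a \<oplus>\<^bsub>X\<^esub> ract X \<xi> b"
    and ract_mult: "\<lbrakk>\<xi> \<in> carrier X; a \<in> carrier A; b \<in> carrier A\<rbrakk>
      \<Longrightarrow> ract X \<xi> (a \<otimes>\<^bsub>A\<^esub> b) = ract X (ract X \<xi> a) b"
    and ract_scale_left: "\<lbrakk>\<xi> \<in> carrier X; a \<in> carrier A\<rbrakk>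
      \<Longrightarrow> ract X (c \<odot>\<^bsub>X\<^esub> \<xi>) a = c \<odot>\<^bsub>X\<^esub> ract X \<xi> a"
    and ract_scale_right: "\<lbrakk>\<xi> \<in> carrier X; a \<in> carrier A\<rbrakk>
      \<Longrightarrow> ract X \<xi> (c \<odot>\<^bsub>A\<^esub> a) = c \<odot>\<^bsub>X\<^esub> ract X \<xi> a"
    and inner_closed: "\<lbrakk>\<xi> \<in> carrier X; \<eta> \<in> carrier X\<rbrakk> \<Longrightarrow> inner X \<xi> \<eta> \<in> carrier A"
    and inner_add: "\<lbrakk>\<xi> \<in> carrier X; \<eta> \<in> carrier X; \<zeta> \<in> carrier X\<rbrakk>
      \<Longrightarrow> inner X \<xi> (\<eta> \<oplus>\<^bsub>X\<^esub> \<zeta>) = inner X \<xi> \<eta> \<oplus>\<^bsub>A\<^esub> inner X \<xi> \<zeta>"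
    and inner_scale: "\<lbrakk>\<xi> \<in> carrier X; \<eta> \<in> carrier X\<rbrakk>
      \<Longrightarrow> inner X \<xi> (c \<odot>\<^bsub>X\<^esub> \<eta>) = c \<odot>\<^bsub>A\<^esub> inner X \<xi> \<eta>"
    and inner_ract: "\<lbrakk>\<xi> \<in> carrier X; \<eta> \<in> carrier X; a \<in> carrier A\<rbrakk>
      \<Longrightarrow> inner X \<xi> (ract X \<eta> a) = inner X \<xi> \<eta> \<otimes>\<^bsub>A\<^esub> a"
    and inner_star: "\<lbrakk>\<xi> \<in> carrier X; \<eta> \<in> carrier X\<rbrakk>
      \<Longrightarrow> star A (inner X \<xi> \<eta>) = inner X \<eta> \<xi>"
    and inner_pos: "\<xi> \<in> carrier X \<Longrightarrow> inner X \<xi> \<xi> \<in> cstar_positive A"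
    and inner_definite: "\<lbrakk>\<xi> \<in> carrier X; inner X \<xi> \<xi> = \<zero>\<^bsub>A\<^esub>\<rbrakk> \<Longrightarrow> \<xi> = \<zero>\<^bsub>X\<^esub>"
    and hnorm_complete: "Metric_space.mcomplete (carrier X) (norm_dist X (hnorm A X))"

definition is_adjoint :: "('x, 'a) hilbert_module \<Rightarrow> ('x \<Rightarrow> 'x) \<Rightarrow> ('x \<Rightarrow> 'x) \<Rightarrow> bool"
  where "is_adjoint X T S \<longleftrightarrow>
    T \<in> carrier X \<rightarrow>\<^sub>E carrier X \<and> S \<in> carrier X \<rightarrow>\<^sub>E carrier X \<and>
    (\<forall>\<xi>\<in>carrier X. \<forall>\<eta>\<in>carrier X. inner X (T \<xi>) \<eta> = inner X \<xi> (S \<eta>))"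

text \<open>Adjointable maps are automatically linear and bounded, so the supremum below is that of a
  nonempty bounded set of reals.\<close>

definition adjointable_operators :: "'a cstar \<Rightarrow> ('x, 'a) hilbert_module \<Rightarrow> ('x \<Rightarrow> 'x) cstar"
    (\<open>\<L>\<close>)
  where "\<L> A X = \<lparr>
    carrier = {T. \<exists>S. is_adjoint X T S},
    monoid.mult = compose (carrier X),
    one = (\<lambda>\<xi>\<in>carrier X. \<xi>),
    zero = (\<lambda>\<xi>\<in>carrier X. \<zero>\<^bsub>X\<^esub>),
    add = (\<lambda>S T. \<lambda>\<xi>\<in>carrier X. S \<xi> \<oplus>\<^bsub>X\<^esub> T \<xi>),
    module.smult = (\<lambda>c T. \<lambda>\<xi>\<in>carrier X. c \<odot>\<^bsub>X\<^esub> T \<xi>),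
    star = (\<lambda>T. THE S. is_adjoint X T S),
    nrm = (\<lambda>T. SUP \<xi>\<in>{\<xi> \<in> carrier X. hnorm A X \<xi> \<le> 1}. hnorm A X (T \<xi>))\<rparr>"

definition theta :: "('x, 'a) hilbert_module \<Rightarrow> 'x \<Rightarrow> 'x \<Rightarrow> 'x \<Rightarrow> 'x" (\<open>\<theta>\<close>)
  where "\<theta> X \<xi> \<eta> = (\<lambda>\<zeta>\<in>carrier X. ract X \<xi> (inner X \<eta> \<zeta>))"

definition compact_operators :: "'a cstar \<Rightarrow> ('x, 'a) hilbert_module \<Rightarrow> ('x \<Rightarrow> 'x) cstar"
    (\<open>\<K>\<close>)
  where "\<K> A X = (\<L> A X)\<lparr>carrier :=
    Metric_space.mtopology (carrier (\<L> A X)) (norm_dist (\<L> A X) (nrm (\<L> A X))) closure_of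
      ((\<lambda>V. submodule V complex_field (\<L> A X)) hull
        {\<theta> X \<xi> \<eta> | \<xi> \<eta>. \<xi> \<in> carrier X \<and> \<eta> \<in> carrier X})\<rparr>"


section \<open>C*-correspondences\<close>

record ('x, 'a) correspondence =
  coeff_alg :: "'a cstar"
  space :: "('x, 'a) hilbert_module"
  lact :: "'a \<Rightarrow> 'x \<Rightarrow> 'x"

definition cstar_correspondence :: "('x, 'a) correspondence \<Rightarrow> bool"
  where "cstar_correspondence E \<longleftrightarrow>
    right_hilbert_module (coeff_alg E) (space E) \<and>
    lact E \<in> star_homs (coeff_alg E) (\<L> (coeff_alg E) (space E))"

definition covariance_ideal :: "('x, 'a) correspondence \<Rightarrow> 'a set" (\<open>\<J>\<close>)
  where "\<J> E = {a \<in> carrier (coeff_alg E).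
    lact E a \<in> carrier (\<K> (coeff_alg E) (space E)) \<and>
    (\<forall>b \<in> a_kernel (coeff_alg E) (\<L> (coeff_alg E) (space E)) (lact E).
      a \<otimes>\<^bsub>coeff_alg E\<^esub> b = \<zero>\<^bsub>coeff_alg E\<^esub>)}"

text \<open>\<open>is_plus E F \<psi> P\<close> says that \<open>P\<close> restricts to the *-homomorphism \<open>\<psi>\<^sup>+\<close> between the compact
  operators. If \<open>\<psi>\<close> belongs to a pair that satisfies the condition \<open>C1\<close> below, such a \<open>P\<close> exists
  and its values on the compact operators are determined, so the existential quantifier in
  condition \<open>C4\<close> is a definite description of \<open>\<psi>\<^sup>+\<close>.\<close>

definition is_plus ::
    "('x, 'a) correspondence \<Rightarrow> ('y, 'b) correspondence \<Rightarrow> ('x \<Rightarrow> 'y) \<Rightarrow>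
      (('x \<Rightarrow> 'x) \<Rightarrow> ('y \<Rightarrow> 'y)) \<Rightarrow> bool"
  where "is_plus E F \<psi> P \<longleftrightarrow>
    star_hom (\<K> (coeff_alg E) (space E)) (\<K> (coeff_alg F) (space F)) P \<and>
    (\<forall>\<xi>\<in>carrier (space E). \<forall>\<eta>\<in>carrier (space E).
      P (\<theta> (space E) \<xi> \<eta>) = \<theta> (space F) (\<psi> \<xi>) (\<psi> \<eta>))"

definition linear_maps ::
    "('x, 'a) hilbert_module \<Rightarrow> ('y, 'b) hilbert_module \<Rightarrow> ('x \<Rightarrow> 'y) set"
  where "linear_maps X Y = {f \<in> carrier X \<rightarrow>\<^sub>E carrier Y.
    (\<forall>\<xi>\<in>carrier X. \<forall>\<eta>\<in>carrier X. f (\<xi> \<oplus>\<^bsub>X\<^esub> \<eta>) = f \<xi> \<oplus>\<^bsub>Y\<^esub> f \<eta>) \<and>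
    (\<forall>c. \<forall>\<xi>\<in>carrier X. f (c \<odot>\<^bsub>X\<^esub> \<xi>) = c \<odot>\<^bsub>Y\<^esub> f \<xi>)}"

locale correspondence_morphism =
  fixes E :: "('x, 'a) correspondence" and F :: "('y, 'b) correspondence"
    and \<psi>X :: "'x \<Rightarrow> 'y" and \<psi>A :: "'a \<Rightarrow> 'b"
  assumes linear: "\<psi>X \<in> linear_maps (space E) (space F)"
    and star_hom: "\<psi>A \<in> star_homs (coeff_alg E) (coeff_alg F)"
    and C1: "\<lbrakk>\<xi> \<in> carrier (space E); \<eta> \<in> carrier (space E)\<rbrakk>
      \<Longrightarrow> inner (space F) (\<psi>X \<xi>) (\<psi>X \<eta>) = \<psi>A (inner (space E) \<xi> \<eta>)"
    and C2: "\<lbrakk>\<xi> \<in> carrier (space E); a \<in> carrier (coeff_alg E)\<rbrakk>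
      \<Longrightarrow> \<psi>X (lact E a \<xi>) = lact F (\<psi>A a) (\<psi>X \<xi>)"
    and C3: "\<psi>A ` \<J> E \<subseteq> \<J> F"
    and C4: "\<exists>P. is_plus E F \<psi>X P \<and> (\<forall>a\<in>\<J> E. lact F (\<psi>A a) = P (lact E a))"


section \<open>Covariant representations and the universal C*-algebra\<close>

definition algebra_correspondence :: "'d cstar \<Rightarrow> ('d, 'd) correspondence"
  where "algebra_correspondence D = \<lparr>
    coeff_alg = D,
    space = \<lparr>carrier = carrier D, monoid.mult = monoid.mult D, one = one D, zero = zero D, add = add D,
      module.smult = module.smult D, ract = monoid.mult D, inner = (\<lambda>a b. star D a \<otimes>\<^bsub>D\<^esub> b)\<rparr>,
    lact = (\<lambda>a\<in>carrier D. \<lambda>b\<in>carrier D. a \<otimes>\<^bsub>D\<^esub> b)\<rparr>"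

abbreviation covariant_representation ::
    "('x, 'a) correspondence \<Rightarrow> 'd cstar \<Rightarrow> ('x \<Rightarrow> 'd) \<Rightarrow> ('a \<Rightarrow> 'd) \<Rightarrow> bool"
  where "covariant_representation E D \<rho>X \<rho>A \<equiv>
    correspondence_morphism E (algebra_correspondence D) \<rho>X \<rho>A"

text \<open>\<open>universal_representation E U \<pi>X \<pi>A\<close> says that the C*-algebra \<open>U\<close> together with \<open>(\<pi>X, \<pi>A)\<close>
  is a universal C*-algebra \<open>\<O>\<^sub>X\<close> for covariant representations of \<open>E\<close>. In HOL the type of the test
  algebras \<open>D\<close> has to be fixed; it is the type that carries \<open>U\<close>, so that \<open>D\<close> ranges over all
  objects of the category of C*-algebras that contains \<open>U\<close>.\<close>

locale universal_representation =
  fixes E :: "('x, 'a) correspondence" and U :: "'u cstar"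
    and \<pi>X :: "'x \<Rightarrow> 'u" and \<pi>A :: "'a \<Rightarrow> 'u"
  assumes cstar: "cstar_algebra U"
    and covariant: "covariant_representation E U \<pi>X \<pi>A"
    and generated: "\<lbrakk>cstar_subalgebra S U; \<pi>X ` carrier (space E) \<subseteq> S;
      \<pi>A ` carrier (coeff_alg E) \<subseteq> S\<rbrakk> \<Longrightarrow> S = carrier U"
    and universal: "\<And>(D :: 'u cstar) \<rho>X \<rho>A.
      \<lbrakk>cstar_algebra D; covariant_representation E D \<rho>X \<rho>A\<rbrakk> \<Longrightarrow>
      \<exists>!P. P \<in> star_homs U D \<and>
        (\<forall>\<xi>\<in>carrier (space E). \<rho>X \<xi> = P (\<pi>X \<xi>)) \<and>
        (\<forall>a\<in>carrier (coeff_alg E). \<rho>A a = P (\<pi>A a))"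


section \<open>Categories and functors\<close>

text \<open>Categories are given by hom-sets; composition \<open>Comp C a b c g f\<close> is \<open>g \<circ> f\<close> for
  \<open>f : a \<rightarrow> b\<close> and \<open>g : b \<rightarrow> c\<close>. The indexing by objects is needed because extensional
  composition depends on the domain.\<close>

record ('o, 'm) category =
  Obj :: "'o set"
  Hom :: "'o \<Rightarrow> 'o \<Rightarrow> 'm set"
  Id :: "'o \<Rightarrow> 'm"
  Comp :: "'o \<Rightarrow> 'o \<Rightarrow> 'o \<Rightarrow> 'm \<Rightarrow> 'm \<Rightarrow> 'm"

locale is_category =
  fixes C :: "('o, 'm) category"
  assumes Id_in: "a \<in> Obj C \<Longrightarrow> Id C a \<in> Hom C a a"
    and Comp_in: "\<lbrakk>a \<in> Obj C; b \<in> Obj C; c \<in> Obj C; f \<in> Hom C a b; g \<in> Hom C b c\<rbrakk>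
      \<Longrightarrow> Comp C a b c g f \<in> Hom C a c"
    and Comp_Id_left: "\<lbrakk>a \<in> Obj C; b \<in> Obj C; f \<in> Hom C a b\<rbrakk>
      \<Longrightarrow> Comp C a b b (Id C b) f = f"
    and Comp_Id_right: "\<lbrakk>a \<in> Obj C; b \<in> Obj C; f \<in> Hom C a b\<rbrakk>
      \<Longrightarrow> Comp C a a b f (Id C a) = f"
    and Comp_assoc: "\<lbrakk>a \<in> Obj C; b \<in> Obj C; c \<in> Obj C; d \<in> Obj C;
        f \<in> Hom C a b; g \<in> Hom C b c; h \<in> Hom C c d\<rbrakk>
      \<Longrightarrow> Comp C a b d (Comp C b c d h g) f = Comp C a c d h (Comp C a b c g f)"

locale covariant_functor = C: is_category C + D: is_category D
  for C :: "('o, 'm) category" and D :: "('p, 'n) category" +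
  fixes F_obj :: "'o \<Rightarrow> 'p" and F_mor :: "'o \<Rightarrow> 'o \<Rightarrow> 'm \<Rightarrow> 'n"
  assumes F_obj_in: "a \<in> Obj C \<Longrightarrow> F_obj a \<in> Obj D"
    and F_mor_in: "\<lbrakk>a \<in> Obj C; b \<in> Obj C; f \<in> Hom C a b\<rbrakk>
      \<Longrightarrow> F_mor a b f \<in> Hom D (F_obj a) (F_obj b)"
    and F_Id: "a \<in> Obj C \<Longrightarrow> F_mor a a (Id C a) = Id D (F_obj a)"
    and F_Comp: "\<lbrakk>a \<in> Obj C; b \<in> Obj C; c \<in> Obj C; f \<in> Hom C a b; g \<in> Hom C b c\<rbrakk>
      \<Longrightarrow> F_mor a c (Comp C a b c g f) =
        Comp D (F_obj a) (F_obj b) (F_obj c) (F_mor b c g) (F_mor a b f)"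

definition correspondence_category ::
    "(('x, 'a) correspondence, ('x \<Rightarrow> 'x) \<times> ('a \<Rightarrow> 'a)) category"
  where "correspondence_category = \<lparr>
    Obj = {E. cstar_correspondence E},
    Hom = (\<lambda>E F. {(\<psi>X, \<psi>A). correspondence_morphism E F \<psi>X \<psi>A}),
    Id = (\<lambda>E. (\<lambda>\<xi>\<in>carrier (space E). \<xi>, \<lambda>a\<in>carrier (coeff_alg E). a)),
    Comp = (\<lambda>E F G (\<psi>X', \<psi>A') (\<psi>X, \<psi>A).
      (compose (carrier (space E)) \<psi>X' \<psi>X, compose (carrier (coeff_alg E)) \<psi>A' \<psi>A))\<rparr>"

definition cstar_category :: "('u cstar, 'u \<Rightarrow> 'u) category"
  where "cstar_category = \<lparr>
    Obj = {A. cstar_algebra A},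
    Hom = star_homs,
    Id = (\<lambda>A. \<lambda>x\<in>carrier A. x),
    Comp = (\<lambda>A B C. compose (carrier A))\<rparr>"

text \<open>The map \<open>\<Psi>\<close> induced by \<open>(\<psi>X, \<psi>A) : E \<rightarrow> F\<close>, relative to a choice \<open>(\<O>, \<pi>X, \<pi>A)\<close> of
  universal C*-algebras and universal covariant representations.\<close>

definition induced_hom ::
    "(('x, 'a) correspondence \<Rightarrow> 'u cstar) \<Rightarrow>
      (('x, 'a) correspondence \<Rightarrow> 'x \<Rightarrow> 'u) \<Rightarrow> (('x, 'a) correspondence \<Rightarrow> 'a \<Rightarrow> 'u) \<Rightarrow>
      ('x, 'a) correspondence \<Rightarrow> ('x, 'a) correspondence \<Rightarrow>
      ('x \<Rightarrow> 'x) \<times> ('a \<Rightarrow> 'a) \<Rightarrow> 'u \<Rightarrow> 'u"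
  where "induced_hom \<O> \<pi>X \<pi>A E F = (\<lambda>(\<psi>X, \<psi>A).
    THE \<Psi>. \<Psi> \<in> star_homs (\<O> E) (\<O> F) \<and>
      (\<forall>\<xi>\<in>carrier (space E). \<Psi> (\<pi>X E \<xi>) = \<pi>X F (\<psi>X \<xi>)) \<and>
      (\<forall>a\<in>carrier (coeff_alg E). \<Psi> (\<pi>A E a) = \<pi>A F (\<psi>A a)))"

end

theory Submission
  imports Defs
begin

text \<open>A morphism \<open>E \<rightarrow> F\<close> followed by the universal covariant representation of \<open>F\<close> is a
  covariant representation of \<open>E\<close>, because \<open>\<psi>\<^sup>+\<close> is compatible with composition. The universal
  property therefore yields exactly one \<open>\<Psi>\<close>. The identity and the composite of two such
  \<open>\<Psi>\<close> satisfy the equations that determine the image of the identity and of the composite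
  morphism, so both equal it by uniqueness.\<close>

text \<open>Makes every complex number a scalar by simplification, which discharges the side
  condition \<open>c \<in> carrier complex_field\<close> of the module rules.\<close>

lemma carrier_complex_field [simp]: "carrier complex_field = UNIV"
  by (simp add: ring_of_type_algebra_def)

section \<open>Star-homomorphisms and their extensional versions\<close>

lemma star_homI:
  assumes "\<And>x. x \<in> carrier A \<Longrightarrow> f x \<in> carrier B"
    and "\<And>x y. \<lbrakk>x \<in> carrier A; y \<in> carrier A\<rbrakk> \<Longrightarrow> f (x \<oplus>\<^bsub>A\<^esub> y) = f x \<oplus>\<^bsub>B\<^esub> f y"
    and "\<And>c x. x \<in> carrier A \<Longrightarrow> f (c \<odot>\<^bsub>A\<^esub> x) = c \<odot>\<^bsub>B\<^esub> f x"
    and "\<And>x y. \<lbrakk>x \<in> carrier A; y \<in> carrier A\<rbrakk> \<Longrightarrow> f (x \<otimes>\<^bsub>A\<^esub> y) = f x \<otimes>\<^bsub>B\<^esub> f y"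
    and "\<And>x. x \<in> carrier A \<Longrightarrow> f (star A x) = star B (f x)"
  shows "star_hom A B f"
  using assms unfolding star_hom_def by blast

lemma star_homD:
  assumes "star_hom A B f"
  shows "x \<in> carrier A \<Longrightarrow> f x \<in> carrier B"
    and "\<lbrakk>x \<in> carrier A; y \<in> carrier A\<rbrakk> \<Longrightarrow> f (x \<oplus>\<^bsub>A\<^esub> y) = f x \<oplus>\<^bsub>B\<^esub> f y"
    and "x \<in> carrier A \<Longrightarrow> f (c \<odot>\<^bsub>A\<^esub> x) = c \<odot>\<^bsub>B\<^esub> f x"
    and "\<lbrakk>x \<in> carrier A; y \<in> carrier A\<rbrakk> \<Longrightarrow> f (x \<otimes>\<^bsub>A\<^esub> y) = f x \<otimes>\<^bsub>B\<^esub> f y"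
    and "x \<in> carrier A \<Longrightarrow> f (star A x) = star B (f x)"
  using assms unfolding star_hom_def by blast+

lemma star_hom_ident: "star_hom A A (\<lambda>x. x)"
  by (rule star_homI) auto

text \<open>\<open>star_hom\<close> speaks only of values on carriers, so \<open>A\<close>,
  \<open>B\<close> and \<open>C\<close> can be any structures. This allows its use for
  \<open>\<K>\<close> without first proving that the compact operators form a C*-algebra.\<close>

lemma star_hom_comp:
  assumes "star_hom A B f" "star_hom B C g"
  shows "star_hom A C (\<lambda>x. g (f x))"
  by (rule star_homI) (simp_all add: star_homD[OF assms(1)] star_homD[OF assms(2)])

lemma star_homs_mapsto: "f \<in> star_homs A B \<Longrightarrow> x \<in> carrier A \<Longrightarrow> f x \<in> carrier B"
  unfolding star_homs_def by (blast dest: star_homD(1))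

context cstar_algebra
begin

text \<open>At a sum, product, adjoint or scalar multiple the restriction takes the value of
  \<open>f\<close> because that element lies in \<open>carrier A\<close>; this is where the closure
  axioms of \<open>A\<close> enter.\<close>

lemma restrict_in_star_homs:
  assumes "star_hom A B f"
  shows "restrict f (carrier A) \<in> star_homs A B"
  unfolding star_homs_def
  by (auto intro!: star_homI simp: star_homD[OF assms] mult_closed star_closed)

lemma ident_in_star_homs: "(\<lambda>x\<in>carrier A. x) \<in> star_homs A A"
  by (rule restrict_in_star_homs[OF star_hom_ident])

lemma compose_in_star_homs:
  assumes "f \<in> star_homs A B" "g \<in> star_homs B C"
  shows "compose (carrier A) g f \<in> star_homs A C"
  using restrict_in_star_homs[OF star_hom_comp] assms
  unfolding star_homs_def compose_def by blast

end

section \<open>Linear maps and left actions\<close>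

lemma ident_in_linear_maps:
  fixes X :: "('x, 'a) hilbert_module"
  assumes "Module.module complex_field X"
  shows "(\<lambda>\<xi>\<in>carrier X. \<xi>) \<in> linear_maps X X"
proof -
  interpret X: Module.module complex_field X by fact
  show ?thesis unfolding linear_maps_def by auto
qed

lemma linear_maps_mapsto: "f \<in> linear_maps X Y \<Longrightarrow> \<xi> \<in> carrier X \<Longrightarrow> f \<xi> \<in> carrier Y"
  unfolding linear_maps_def by auto

lemma compose_in_linear_maps:
  fixes X :: "('x, 'a) hilbert_module"
  assumes "Module.module complex_field X" "f \<in> linear_maps X Y" "g \<in> linear_maps Y Z"
  shows "compose (carrier X) g f \<in> linear_maps X Z"
proof -
  interpret X: Module.module complex_field X by fact
  from assms(2,3) show ?thesis
    unfolding linear_maps_def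
    by (auto simp: compose_eq Pi_iff PiE_iff compose_def)
qed

text \<open>Operators in \<open>\<L>\<close> map the module into itself by the function space in
  \<open>is_adjoint\<close>. The fact serves \<open>C2\<close>, where a restricted map is evaluated
  at \<open>lact E a \<xi>\<close>.\<close>

lemma lact_closed:
  assumes "cstar_correspondence E" "a \<in> carrier (coeff_alg E)" "\<xi> \<in> carrier (space E)"
  shows "lact E a \<xi> \<in> carrier (space E)"
proof -
  have "lact E \<in> star_homs (coeff_alg E) (\<L> (coeff_alg E) (space E))"
    using assms(1) unfolding cstar_correspondence_def by blast
  from star_homs_mapsto[OF this assms(2)]
  have "lact E a \<in> carrier (\<L> (coeff_alg E) (space E))" .
  then show ?thesis
    using assms(3) unfolding adjointable_operators_def is_adjoint_def by auto
qed

section \<open>Identities and composites of morphisms of correspondences\<close>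

lemma covariance_ideal_subset: "\<J> E \<subseteq> carrier (coeff_alg E)"
  unfolding covariance_ideal_def by blast

text \<open>On a \<open>\<theta>\<close> operator the formula for \<open>P'\<close> is applied at
  \<open>\<psi> \<xi>\<close> and \<open>\<psi> \<eta>\<close>, which lie in
  \<open>carrier (space F)\<close>. As \<open>C4\<close> asks only for some \<open>P\<close>, this
  composite can serve as the witness.\<close>

lemma is_plus_comp:
  assumes "\<psi> \<in> linear_maps (space E) (space F)" "is_plus E F \<psi> P" "is_plus F G \<psi>' P'"
  shows "is_plus E G (compose (carrier (space E)) \<psi>' \<psi>) (\<lambda>T. P' (P T))"
  using assms(2,3) star_hom_comp[of _ _ P _ P'] unfolding is_plus_def
  by (auto simp: compose_eq linear_maps_mapsto[OF assms(1)])

lemma correspondence_morphism_ident: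
  assumes "cstar_correspondence E"
  shows "correspondence_morphism E E (\<lambda>\<xi>\<in>carrier (space E). \<xi>)
    (\<lambda>a\<in>carrier (coeff_alg E). a)"
proof -
  interpret right_hilbert_module "coeff_alg E" "space E"
    using assms unfolding cstar_correspondence_def by blast
  show ?thesis
  proof
    \<comment> \<open>The unrestricted identity can be the witness, since \<open>is_plus\<close>
      does not demand extensionality of it.\<close>
    have "is_plus E E (\<lambda>\<xi>\<in>carrier (space E). \<xi>) (\<lambda>T. T)"
      unfolding is_plus_def by (simp add: star_hom_ident)
    then show "\<exists>P. is_plus E E (\<lambda>\<xi>\<in>carrier (space E). \<xi>) P \<and>
        (\<forall>a\<in>\<J> E. lact E ((\<lambda>a\<in>carrier (coeff_alg E). a) a) = P (lact E a))"
      using covariance_ideal_subset[of E] by (intro exI[of _ "\<lambda>T. T"]) auto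
  qed (use covariance_ideal_subset[of E] in
      \<open>auto simp: ident_in_linear_maps[OF X.module_axioms] A.ident_in_star_homs inner_closed
        lact_closed[OF assms]\<close>)
qed

text \<open>Only the source has to be a correspondence, as the restricted composites are evaluated
  there. So \<open>G\<close> may be \<open>algebra_correspondence D\<close>, and the lemma also
  pulls a representation of \<open>F\<close> back to \<open>E\<close>.\<close>

lemma correspondence_morphism_compose:
  assumes "cstar_correspondence E"
    and "correspondence_morphism E F \<psi>X \<psi>A" "correspondence_morphism F G \<psi>X' \<psi>A'"
  shows "correspondence_morphism E G (compose (carrier (space E)) \<psi>X' \<psi>X)
    (compose (carrier (coeff_alg E)) \<psi>A' \<psi>A)"
proof -
  interpret right_hilbert_module "coeff_alg E" "space E"
    using assms unfolding cstar_correspondence_def by blast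
  interpret f: correspondence_morphism E F \<psi>X \<psi>A by fact
  interpret g: correspondence_morphism F G \<psi>X' \<psi>A' by fact
  note maps = linear_maps_mapsto[OF f.linear] star_homs_mapsto[OF f.star_hom]
  show ?thesis
  proof
    obtain P P' where P: "is_plus E F \<psi>X P" "\<forall>a\<in>\<J> E. lact F (\<psi>A a) = P (lact E a)"
      and P': "is_plus F G \<psi>X' P'" "\<forall>a\<in>\<J> F. lact G (\<psi>A' a) = P' (lact F a)"
      using f.C4 g.C4 by blast
    \<comment> \<open>\<open>C3\<close> of the first morphism puts \<open>\<psi>A a\<close> into
      \<open>\<J> F\<close>, where \<open>C4\<close> of the second gives
      \<open>P' (lact F (\<psi>A a))\<close>; \<open>C4\<close> of the first then rewrites the
      argument to \<open>P (lact E a)\<close>.\<close>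
    have "lact G (compose (carrier (coeff_alg E)) \<psi>A' \<psi>A a) = P' (P (lact E a))"
      if "a \<in> \<J> E" for a
      using that P(2) P'(2) f.C3 covariance_ideal_subset[of E]
      by (auto simp: compose_eq subset_iff image_subset_iff)
    with is_plus_comp[OF f.linear P(1) P'(1)]
    show "\<exists>P. is_plus E G (compose (carrier (space E)) \<psi>X' \<psi>X) P \<and>
        (\<forall>a\<in>\<J> E. lact G (compose (carrier (coeff_alg E)) \<psi>A' \<psi>A a) = P (lact E a))"
      by blast
    show "compose (carrier (coeff_alg E)) \<psi>A' \<psi>A ` \<J> E \<subseteq> \<J> G"
      using f.C3 g.C3 covariance_ideal_subset[of E]
      by (auto simp: compose_eq subset_iff image_subset_iff)
  qed (simp_all add: compose_in_linear_maps[OF X.module_axioms f.linear g.linear]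
      A.compose_in_star_homs[OF f.star_hom g.star_hom] compose_eq maps inner_closed
      lact_closed[OF assms(1)] f.C1 f.C2 g.C1 g.C2)
qed

section \<open>The two categories\<close>

lemma is_category_correspondence:
  "is_category (correspondence_category :: (('x, 'a) correspondence, _) category)"
proof
  fix E F G H :: "('x, 'a) correspondence" and f g h
  show "Id correspondence_category E \<in> Hom correspondence_category E E"
    if "E \<in> Obj correspondence_category"
    using that by (simp add: correspondence_category_def correspondence_morphism_ident)
  show "Comp correspondence_category E F G g f \<in> Hom correspondence_category E G"
    if "E \<in> Obj correspondence_category"
      "f \<in> Hom correspondence_category E F" "g \<in> Hom correspondence_category F G"
    using that by (auto simp: correspondence_category_def correspondence_morphism_compose)
  assume f: "f \<in> Hom correspondence_category E F"
  then obtain \<psi>X \<psi>A where [simp]: "f = (\<psi>X, \<psi>A)" and m: "correspondence_morphism E F \<psi>X \<psi>A"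
    unfolding correspondence_category_def by auto
  interpret f: correspondence_morphism E F \<psi>X \<psi>A by fact
  \<comment> \<open>The identity laws are equalities of HOL functions, so they need extensionality
    besides values in the right carriers.\<close>
  have maps: "\<psi>X \<in> carrier (space E) \<rightarrow> carrier (space F)"
    "\<psi>X \<in> extensional (carrier (space E))"
    "\<psi>A \<in> carrier (coeff_alg E) \<rightarrow> carrier (coeff_alg F)"
    "\<psi>A \<in> extensional (carrier (coeff_alg E))"
    using f.linear f.star_hom
    by (auto simp: linear_maps_def PiE_iff star_homs_def star_hom_def)
  show "Comp correspondence_category E F F (Id correspondence_category F) f = f"
    "Comp correspondence_category E E F f (Id correspondence_category E) = f"
    by (simp_all add: correspondence_category_def Id_compose[OF maps(1,2)] compose_Id[OF maps(1,2)]
        Id_compose[OF maps(3,4)] compose_Id[OF maps(3,4)])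
  \<comment> \<open>Rebracketing changes only whether the values of \<open>f\<close> are tested for
    membership in the carriers of \<open>F\<close>, so it suffices that \<open>f\<close> maps into
    them.\<close>
  show "Comp correspondence_category E F H (Comp correspondence_category F G H h g) f =
      Comp correspondence_category E G H h (Comp correspondence_category E F G g f)"
    by (simp add: correspondence_category_def compose_assoc[OF maps(1)]
        compose_assoc[OF maps(3)] split: prod.split)
qed

lemma is_category_cstar: "is_category (cstar_category :: ('u cstar, _) category)"
proof
  fix A B C D :: "'u cstar" and f g h
  show "Id cstar_category A \<in> Hom cstar_category A A" if "A \<in> Obj cstar_category"
    using that by (simp add: cstar_category_def cstar_algebra.ident_in_star_homs)
  show "Comp cstar_category A B C g f \<in> Hom cstar_category A C"
    if "A \<in> Obj cstar_category" "f \<in> Hom cstar_category A B" "g \<in> Hom cstar_category B C"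
    using that by (simp add: cstar_category_def cstar_algebra.compose_in_star_homs)
  assume "f \<in> Hom cstar_category A B"
  then have maps: "f \<in> carrier A \<rightarrow> carrier B" "f \<in> extensional (carrier A)"
    by (auto simp: cstar_category_def star_homs_def star_hom_def)
  show "Comp cstar_category A B B (Id cstar_category B) f = f"
    "Comp cstar_category A A B f (Id cstar_category A) = f"
    by (simp_all add: cstar_category_def Id_compose[OF maps] compose_Id[OF maps])
  show "Comp cstar_category A B D (Comp cstar_category B C D h g) f =
      Comp cstar_category A C D h (Comp cstar_category A B C g f)"
    by (simp add: cstar_category_def compose_assoc[OF maps(1)])
qed

section \<open>The induced homomorphisms and functoriality\<close>

definition is_induced ::
    "(('x, 'a) correspondence \<Rightarrow> 'u cstar) \<Rightarrow>
      (('x, 'a) correspondence \<Rightarrow> 'x \<Rightarrow> 'u) \<Rightarrow> (('x, 'a) correspondence \<Rightarrow> 'a \<Rightarrow> 'u) \<Rightarrow>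
      ('x, 'a) correspondence \<Rightarrow> ('x, 'a) correspondence \<Rightarrow>
      ('x \<Rightarrow> 'x) \<times> ('a \<Rightarrow> 'a) \<Rightarrow> ('u \<Rightarrow> 'u) \<Rightarrow> bool"
  where "is_induced \<O> \<pi>X \<pi>A E F f \<Psi> \<longleftrightarrow> \<Psi> \<in> star_homs (\<O> E) (\<O> F) \<and>
    (\<forall>\<xi>\<in>carrier (space E). \<Psi> (\<pi>X E \<xi>) = \<pi>X F (fst f \<xi>)) \<and>
    (\<forall>a\<in>carrier (coeff_alg E). \<Psi> (\<pi>A E a) = \<pi>A F (snd f a))"

text \<open>With the morphism kept as a single argument \<open>f\<close>, the rules for
  \<open>THE\<close> apply without splitting the pair.\<close>

lemma induced_hom_eq_The: "induced_hom \<O> \<pi>X \<pi>A E F f = (THE \<Psi>. is_induced \<O> \<pi>X \<pi>A E F f \<Psi>)"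
  by (simp add: induced_hom_def is_induced_def case_prod_beta)

text \<open>The universal property of \<open>\<O> E\<close> is applied to the test algebra
  \<open>\<O> F\<close> and to \<open>f\<close> followed by the universal representation of
  \<open>F\<close>. Its equations are those of \<open>is_induced\<close> with the sides
  exchanged.\<close>

lemma ex1_is_induced:
  fixes \<O> :: "('x, 'a) correspondence \<Rightarrow> 'u cstar"
  assumes "cstar_correspondence E" "universal_representation E (\<O> E) (\<pi>X E) (\<pi>A E)"
    and "universal_representation F (\<O> F) (\<pi>X F) (\<pi>A F)"
    and "f \<in> Hom correspondence_category E F"
  shows "\<exists>!\<Psi>. is_induced \<O> \<pi>X \<pi>A E F f \<Psi>"
proof -
  interpret E: universal_representation E "\<O> E" "\<pi>X E" "\<pi>A E" by fact
  interpret F: universal_representation F "\<O> F" "\<pi>X F" "\<pi>A F" by fact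
  have "correspondence_morphism E F (fst f) (snd f)"
    using assms(4) by (auto simp: correspondence_category_def)
  from E.universal[OF F.cstar correspondence_morphism_compose[OF assms(1) this F.covariant]]
  show ?thesis
    unfolding is_induced_def by (simp add: compose_eq eq_commute[of "\<pi>X F _"] eq_commute[of "\<pi>A F _"])
qed

theorem proposition2p11:
  fixes \<O> :: "('x, 'a) correspondence \<Rightarrow> 'u cstar"
    and \<pi>X :: "('x, 'a) correspondence \<Rightarrow> 'x \<Rightarrow> 'u"
    and \<pi>A :: "('x, 'a) correspondence \<Rightarrow> 'a \<Rightarrow> 'u"
  assumes universal: "\<And>E. cstar_correspondence E \<Longrightarrow>
    universal_representation E (\<O> E) (\<pi>X E) (\<pi>A E)"
  shows "covariant_functor correspondence_category cstar_category \<O> (induced_hom \<O> \<pi>X \<pi>A)"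
proof -
  let ?C = "correspondence_category :: (('x, 'a) correspondence, _) category"
  let ?D = "cstar_category :: ('u cstar, _) category"
  interpret C: is_category ?C by (rule is_category_correspondence)
  interpret D: is_category ?D by (rule is_category_cstar)
  have ObjD: "cstar_correspondence E" if "E \<in> Obj ?C" for E
    using that by (simp add: correspondence_category_def)
  have ex1: "\<exists>!\<Psi>. is_induced \<O> \<pi>X \<pi>A E F f \<Psi>"
    if "E \<in> Obj ?C" "F \<in> Obj ?C" "f \<in> Hom ?C E F" for E F f
    using that by (intro ex1_is_induced universal ObjD)
  have induced: "is_induced \<O> \<pi>X \<pi>A E F f (induced_hom \<O> \<pi>X \<pi>A E F f)"
    if "E \<in> Obj ?C" "F \<in> Obj ?C" "f \<in> Hom ?C E F" for E F f
    unfolding induced_hom_eq_The by (rule theI'[OF ex1[OF that]])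
  have unique: "induced_hom \<O> \<pi>X \<pi>A E F f = \<Psi>"
    if "E \<in> Obj ?C" "F \<in> Obj ?C" "f \<in> Hom ?C E F" "is_induced \<O> \<pi>X \<pi>A E F f \<Psi>" for E F f \<Psi>
    unfolding induced_hom_eq_The using the1_equality[where P = "is_induced \<O> \<pi>X \<pi>A E F f"] ex1[OF that(1-3)] that(4)
    by blast
  have \<O>_in: "\<O> E \<in> Obj ?D" if "E \<in> Obj ?C" for E
    using universal_representation.cstar[OF universal[OF ObjD[OF that]]]
    by (simp add: cstar_category_def)
  \<comment> \<open>Identity and composite in \<open>cstar_category\<close> are restricted to
    \<open>carrier (\<O> E)\<close>, so they can be evaluated at generators only once these are
    known to lie there.\<close>
  have \<pi>_in: "\<xi> \<in> carrier (space E) \<Longrightarrow> \<pi>X E \<xi> \<in> carrier (\<O> E)"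
    "a \<in> carrier (coeff_alg E) \<Longrightarrow> \<pi>A E a \<in> carrier (\<O> E)"
    if "E \<in> Obj ?C" for E \<xi> a
  proof -
    interpret correspondence_morphism E "algebra_correspondence (\<O> E)" "\<pi>X E" "\<pi>A E"
      using universal_representation.covariant[OF universal[OF ObjD[OF that]]] .
    show "\<xi> \<in> carrier (space E) \<Longrightarrow> \<pi>X E \<xi> \<in> carrier (\<O> E)"
      using linear_maps_mapsto[OF linear] by (simp add: algebra_correspondence_def)
    show "a \<in> carrier (coeff_alg E) \<Longrightarrow> \<pi>A E a \<in> carrier (\<O> E)"
      using star_homs_mapsto[OF star_hom] by (simp add: algebra_correspondence_def)
  qed
  show ?thesis
  proof
    fix E F G f g
    assume E: "E \<in> Obj ?C"
    show "\<O> E \<in> Obj ?D" by (rule \<O>_in[OF E])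
    have "is_induced \<O> \<pi>X \<pi>A E E (Id ?C E) (Id ?D (\<O> E))"
      using D.Id_in[OF \<O>_in[OF E]]
      by (simp add: is_induced_def correspondence_category_def cstar_category_def \<pi>_in[OF E])
    then show "induced_hom \<O> \<pi>X \<pi>A E E (Id ?C E) = Id ?D (\<O> E)"
      by (rule unique[OF E E C.Id_in[OF E]])
    assume F: "F \<in> Obj ?C" and f: "f \<in> Hom ?C E F"
    note \<Psi> = induced[OF E F f]
    show \<Psi>_in: "induced_hom \<O> \<pi>X \<pi>A E F f \<in> Hom ?D (\<O> E) (\<O> F)"
      using \<Psi> by (simp add: is_induced_def cstar_category_def)
    assume G: "G \<in> Obj ?C" and g: "g \<in> Hom ?C F G"
    note \<Psi>' = induced[OF F G g]
    have \<Psi>'_in: "induced_hom \<O> \<pi>X \<pi>A F G g \<in> Hom ?D (\<O> F) (\<O> G)"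
      using \<Psi>' by (simp add: is_induced_def cstar_category_def)
    \<comment> \<open>The equations for the second induced map hold on the carriers of
      \<open>F\<close>; the interpretation shows that \<open>fst f \<xi>\<close> and
      \<open>snd f a\<close> lie in them.\<close>
    interpret f: correspondence_morphism E F "fst f" "snd f"
      using f by (auto simp: correspondence_category_def)
    \<comment> \<open>On a generator \<open>\<pi>X E \<xi>\<close> the first map gives
      \<open>\<pi>X F (fst f \<xi>)\<close> and the second turns this into
      \<open>\<pi>X G (fst g (fst f \<xi>))\<close>; likewise for \<open>\<pi>A\<close>.\<close>
    have "is_induced \<O> \<pi>X \<pi>A E G (Comp ?C E F G g f)
        (Comp ?D (\<O> E) (\<O> F) (\<O> G)
          (induced_hom \<O> \<pi>X \<pi>A F G g) (induced_hom \<O> \<pi>X \<pi>A E F f))"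
      using \<Psi> \<Psi>' D.Comp_in[OF \<O>_in[OF E] \<O>_in[OF F] \<O>_in[OF G] \<Psi>_in \<Psi>'_in]
      by (simp add: is_induced_def correspondence_category_def cstar_category_def
          case_prod_beta compose_eq \<pi>_in[OF E]
          linear_maps_mapsto[OF f.linear] star_homs_mapsto[OF f.star_hom])
    then show "induced_hom \<O> \<pi>X \<pi>A E G (Comp ?C E F G g f) =
        Comp ?D (\<O> E) (\<O> F) (\<O> G)
          (induced_hom \<O> \<pi>X \<pi>A F G g) (induced_hom \<O> \<pi>X \<pi>A E F f)"
      by (rule unique[OF E G C.Comp_in[OF E F G f g]])
  qed
qed

end
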